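(* Let $E$ be a Euclidean space, let $S$ and $\mathcal{X}$ be nonempty compact subsets of $E$, and let $\epsilon:\mathcal{X}\to\mathbb{R}$ be a function such that: (1) $d(x,\Delta_S)>5\epsilon(x)$ for all $x\in\mathcal{X}$; (2) $d(x,S)<\frac13\epsilon(x)$ for all $x\in\mathcal{X}$; (3) for every $p\in S$ there is $x\in\mathcal{X}$ with $\|x-p\|<\frac14\epsilon(x)$; (4) $|\epsilon(x)-\epsilon(y)|<\frac1{17}\|x-y\|$ for all distinct $x,y\in\mathcal{X}$. Then $S$ is a deformation retract of $\mathcal{U}(\mathcal{X},\epsilon)=\bigcup_{x\in\mathcal{X}}B(x,\epsilon(x))$.
   Context: $B(x,r)$ denotes the open Euclidean ball of center $x$ and radius $r$; $d(x,A)=\inf_{a\in A}\|x-a\|$ (equal to $+\infty$ if $A=\emptyset$). For nonempty $S\subset E$, the medial axis $\Delta_S$ is the closure of the set $\{x\in E\mid \exists p,q\in S,\ p\ne q,\ \|x-p\|=\|x-q\|=d(x,S)\}$. *)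

theory Defs
  imports "HOL-Analysis.Analysis"
begin

text \<open>
  Extended-real valued, because the distance to the empty set must be \<open>\<infinity>\<close>, whereas
  \<^term>\<open>infdist x {} = 0\<close>. The medial axis of a nonempty set can be empty (e.g. for a point).
\<close>
definition point_set_dist :: "'a::metric_space \<Rightarrow> 'a set \<Rightarrow> ereal" where
  "point_set_dist x A = (INF a\<in>A. ereal (dist x a))"

definition medial_axis :: "'a::metric_space set \<Rightarrow> 'a set" where
  "medial_axis S =
     closure {x. \<exists>p\<in>S. \<exists>q\<in>S. p \<noteq> q \<and> dist x p = dist x q \<and>
                              ereal (dist x q) = point_set_dist x S}"

definition offset :: "'a::metric_space set \<Rightarrow> ('a \<Rightarrow> real) \<Rightarrow> 'a set" where
  "offset X \<epsilon> = (\<Union>x\<in>X. ball x (\<epsilon> x))"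

text \<open>
  As in Hatcher and Munkres: the homotopy from the identity to the retraction runs inside \<open>U\<close> and
  keeps every point of \<open>S\<close> fixed at all times (also called a strong deformation retract).
\<close>
definition deformation_retract_of :: "'a::topological_space set \<Rightarrow> 'a set \<Rightarrow> bool"
    (infix \<open>deformation'_retract'_of\<close> 50) where
  "S deformation_retract_of U \<longleftrightarrow>
     (\<exists>r. retraction U S r \<and> homotopic_with_canon (\<lambda>f. \<forall>x\<in>S. f x = x) U U id r)"

end

theory Submission
  imports Defs
begin

text \<open>
  The retraction \<open>\<pi>\<close> is the nearest-point projection, single-valued and continuous off the medial axis,
  and the homotopy moves each point \<open>y\<close> straight towards \<open>p = \<pi> y\<close>. For \<open>y \<in> B(x, e)\<close> with
  \<open>e = \<epsilon> x\<close>, the ray from \<open>p\<close> through \<open>y\<close> can be prolonged by \<open>4e\<close> beyond \<open>y\<close> without meeting the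
  medial axis, and (Federer, by Brouwer's fixed point theorem) \<open>p\<close> remains nearest along it. So the
  end of the ray is far from the point of \<open>S\<close> nearest to \<open>x\<close>, hence far from \<open>x\<close>; convexity of the
  squared distance to \<open>x\<close> along the ray then keeps the segment from \<open>y\<close> to \<open>p\<close> in \<open>B(x, e)\<close> up to
  distance \<open>e/2\<close> from \<open>p\<close>. The rest lies in the ball around a sample point close to \<open>p\<close>, whose radius
  is comparable to \<open>e\<close> by the Lipschitz condition.
\<close>

section \<open>Nearest points and the projection off the medial axis\<close>

text \<open>A relation, because a point may have several nearest points;
  \<open>closest_point\<close> chooses one of them.\<close>

definition nearest_in :: "'a::metric_space set \<Rightarrow> 'a \<Rightarrow> 'a \<Rightarrow> bool" where
  "nearest_in S y p \<longleftrightarrow> p \<in> S \<and> (\<forall>q\<in>S. dist y p \<le> dist y q)"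

lemma nearest_in_closest_point:
  assumes "closed S" "S \<noteq> {}"
  shows "nearest_in S y (closest_point S y)"
  unfolding nearest_in_def
  using closest_point_in_set[OF assms] closest_point_le[OF assms(1)] by blast

lemma point_set_dist_nearest:
  assumes "nearest_in S y p"
  shows "point_set_dist y S = ereal (dist y p)"
  unfolding point_set_dist_def
  by (rule antisym) (use assms in \<open>auto simp: nearest_in_def intro: INF_lower INF_greatest\<close>)

lemma nearest_in_unique:
  assumes "y \<notin> medial_axis S" "nearest_in S y p" "nearest_in S y q"
  shows "p = q"
proof (rule ccontr)
  assume "p \<noteq> q"
  moreover have "dist y p = dist y q" "p \<in> S" "q \<in> S"
    using assms by (auto simp: nearest_in_def intro: antisym)
  moreover have "ereal (dist y q) = point_set_dist y S"
    using point_set_dist_nearest[OF assms(3)] by simp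
  ultimately have "y \<in> {x. \<exists>p\<in>S. \<exists>q\<in>S. p \<noteq> q \<and> dist x p = dist x q \<and>
                              ereal (dist x q) = point_set_dist x S}"
    by blast
  then have "y \<in> medial_axis S"
    unfolding medial_axis_def by (rule subsetD[OF closure_subset])
  with assms(1) show False by contradiction
qed

lemma closest_point_eq_nearest:
  assumes "closed S" "y \<notin> medial_axis S" "nearest_in S y p"
  shows "closest_point S y = p"
  using assms nearest_in_closest_point nearest_in_unique
  by (metis empty_iff nearest_in_def)

text \<open>The second hypothesis puts \<open>c\<close> on the segment from \<open>z\<close> to
  \<open>p\<close>. By the triangle inequality, a point of \<open>S\<close> nearer to
  \<open>c\<close> than \<open>p\<close> would also be nearer to \<open>z\<close>.\<close>

lemma nearest_in_segment:
  fixes p z c :: "'a::euclidean_space"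
  assumes "nearest_in S z p" "dist z p = dist z c + dist c p"
  shows "nearest_in S c p"
  unfolding nearest_in_def
proof (intro conjI ballI)
  show "p \<in> S" using assms by (simp add: nearest_in_def)
  fix q assume "q \<in> S"
  then have "dist z p \<le> dist z q" using assms by (simp add: nearest_in_def)
  also have "\<dots> \<le> dist z c + dist c q" by (rule dist_triangle)
  finally show "dist c p \<le> dist c q" using assms(2) by simp
qed

text \<open>A map into a compact set is continuous when its graph is closed. Here the closed
  inequalities that define \<open>G\<close> cut the graph out of \<open>?N \<times> S\<close>, since
  nearest points are unique off the medial axis.\<close>

lemma continuous_on_closest_point_off_medial_axis:
  fixes S :: "'a::euclidean_space set"
  assumes "compact S" "S \<noteq> {}"
  shows "continuous_on (- medial_axis S) (closest_point S)"
proof -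
  let ?N = "- medial_axis S"
  have cl: "closed S" using assms compact_imp_closed by blast
  define G where "G = (\<Inter>q\<in>S. {z::'a\<times>'a. dist (fst z) (snd z) \<le> dist (fst z) q})"
  have "closed G"
    unfolding G_def by (intro closed_INT ballI closed_Collect_le continuous_intros)
  moreover have "(\<lambda>y. (y, closest_point S y)) ` ?N = (?N \<times> S) \<inter> G"
  proof (intro subset_antisym subsetI)
    fix z assume "z \<in> (\<lambda>y. (y, closest_point S y)) ` ?N"
    then show "z \<in> (?N \<times> S) \<inter> G"
      using nearest_in_closest_point[OF cl assms(2)] by (auto simp: G_def nearest_in_def)
  next
    fix z assume z: "z \<in> (?N \<times> S) \<inter> G"
    then have "nearest_in S (fst z) (snd z)"
      by (auto simp: G_def nearest_in_def)
    then have "closest_point S (fst z) = snd z"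
      using z closest_point_eq_nearest[OF cl] by auto
    then show "z \<in> (\<lambda>y. (y, closest_point S y)) ` ?N"
      using z by (auto simp: image_iff)
  qed
  ultimately have "closedin (top_of_set (?N \<times> S)) ((\<lambda>y. (y, closest_point S y)) ` ?N)"
    by (simp add: closedin_closed_Int)
  then show ?thesis
    using continuous_closed_graph_eq[OF assms(1), of "closest_point S" ?N]
      closest_point_in_set[OF cl assms(2)] by blast
qed

section \<open>Nearest points along a ray\<close>

text \<open>
  A fixed point \<open>z\<close> of \<open>z \<mapsto> c + \<delta> (c - \<pi> z) / |c - \<pi> z|\<close> sees \<open>c\<close> between itself and \<open>\<pi> z\<close>; then
  \<open>\<pi> z\<close> is nearest to \<open>c\<close> too, so \<open>\<pi> z = p\<close> and \<open>z\<close> lies on the ray.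
\<close>
lemma nearest_in_extend:
  fixes S :: "'a::euclidean_space set"
  assumes "compact S" and near: "nearest_in S c p" and "c \<noteq> p"
    and "\<delta> > 0" and disj: "cball c \<delta> \<inter> medial_axis S = {}"
  shows "nearest_in S (c + (\<delta> / norm (c - p)) *\<^sub>R (c - p)) p"
proof -
  have cl: "closed S" and ne: "S \<noteq> {}"
    using assms compact_imp_closed by (auto simp: nearest_in_def)
  let ?\<pi> = "closest_point S"
  have cS: "c \<notin> S"
    using near \<open>c \<noteq> p\<close> unfolding nearest_in_def by force
  have \<pi>S: "?\<pi> z \<in> S" for z
    using closest_point_in_set[OF cl ne] .
  have nz: "norm (c - ?\<pi> z) \<noteq> 0" for z
    using cS \<pi>S[of z] by auto
  define f where "f z = c + (\<delta> / norm (c - ?\<pi> z)) *\<^sub>R (c - ?\<pi> z)" for z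
  have "continuous_on (cball c \<delta>) ?\<pi>"
    using continuous_on_closest_point_off_medial_axis[OF assms(1) ne]
    by (rule continuous_on_subset) (use disj in blast)
  then have "continuous_on (cball c \<delta>) f"
    unfolding f_def using nz by (intro continuous_intros ballI)
  \<comment> \<open>Every value of \<open>f\<close> lies on the sphere of radius \<delta> about
    \<open>c\<close>.\<close>
  moreover have "f \<in> cball c \<delta> \<rightarrow> cball c \<delta>"
    using \<open>\<delta> > 0\<close> nz by (auto simp: f_def dist_norm)
  ultimately obtain z where z: "z \<in> cball c \<delta>" "f z = z"
    using brouwer_ball[OF \<open>\<delta> > 0\<close>] by blast
  have zn: "nearest_in S z (?\<pi> z)"
    using nearest_in_closest_point[OF cl ne] .
  define a where "a = \<delta> / norm (c - ?\<pi> z)"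
  have a: "a > 0" using \<open>\<delta> > 0\<close> nz[of z] by (simp add: a_def)
  have zc: "z - c = a *\<^sub>R (c - ?\<pi> z)"
    using z(2) by (simp add: f_def a_def algebra_simps)
  then have "z - ?\<pi> z = (1 + a) *\<^sub>R (c - ?\<pi> z)"
    by (simp add: algebra_simps)
  then have "dist z (?\<pi> z) = (1 + a) * norm (c - ?\<pi> z)" "dist z c = a * norm (c - ?\<pi> z)"
    using zc a by (simp_all add: dist_norm)
  then have "dist z (?\<pi> z) = dist z c + dist c (?\<pi> z)"
    by (simp add: dist_norm distrib_right)
  then have "nearest_in S c (?\<pi> z)"
    using nearest_in_segment zn by blast
  moreover have "c \<notin> medial_axis S"
    using disj \<open>\<delta> > 0\<close> by (metis centre_in_cball disjoint_iff less_imp_le)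
  ultimately have "?\<pi> z = p"
    using near nearest_in_unique by blast
  then show ?thesis
    using zn z(2) by (simp add: f_def)
qed

text \<open>Continuation argument: the parameters in \<open>[h, T]\<close> for which
  \<open>p\<close> is nearest form a compact set, and \<open>nearest_in_extend\<close> would push a
  maximum below \<open>T\<close> further out.\<close>

lemma nearest_in_ray:
  fixes S :: "'a::euclidean_space set"
  assumes "compact S" and u: "norm u = 1" and "h > 0" "h \<le> T"
    and near: "nearest_in S (p + h *\<^sub>R u) p"
    and disj: "\<And>t. h \<le> t \<Longrightarrow> t \<le> T \<Longrightarrow> p + t *\<^sub>R u \<notin> medial_axis S"
  shows "nearest_in S (p + T *\<^sub>R u) p"
proof -
  define A where "A = {h..T} \<inter> (\<Inter>q\<in>S. {t. dist (p + t *\<^sub>R u) p \<le> dist (p + t *\<^sub>R u) q})"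
  have pS: "p \<in> S" using near by (simp add: nearest_in_def)
  have A_iff: "t \<in> A \<longleftrightarrow> h \<le> t \<and> t \<le> T \<and> nearest_in S (p + t *\<^sub>R u) p" for t
    using pS by (auto simp: A_def nearest_in_def)
  have "closed (\<Inter>q\<in>S. {t. dist (p + t *\<^sub>R u) p \<le> dist (p + t *\<^sub>R u) q})"
    by (intro closed_INT ballI closed_Collect_le continuous_intros)
  then have "compact A"
    unfolding A_def by (intro compact_Int_closed) auto
  moreover have "h \<in> A" using assms by (simp add: A_iff)
  ultimately obtain \<tau> where \<tau>: "\<tau> \<in> A" "\<And>t. t \<in> A \<Longrightarrow> t \<le> \<tau>"
    using compact_attains_sup[of A] by blast
  have "\<tau> = T"
  proof (rule ccontr)
    assume "\<tau> \<noteq> T"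
    then have lt: "\<tau> < T" "h \<le> \<tau>" and n\<tau>: "nearest_in S (p + \<tau> *\<^sub>R u) p"
      using \<tau>(1) by (auto simp: A_iff)
    let ?c = "p + \<tau> *\<^sub>R u"
    \<comment> \<open>The closure in the definition of the medial axis makes the complement open,
      which leaves room for a ball about \<open>?c\<close>.\<close>
    have "open (- medial_axis S)" by (simp add: medial_axis_def open_Compl)
    moreover have "?c \<in> - medial_axis S" using disj lt by simp
    ultimately obtain d where d: "d > 0" "cball ?c d \<subseteq> - medial_axis S"
      using open_contains_cball by blast
    define \<delta> where "\<delta> = min d (T - \<tau>)"
    have \<delta>: "\<delta> > 0" "\<delta> \<le> T - \<tau>" using d lt by (auto simp: \<delta>_def)
    have "cball ?c \<delta> \<subseteq> cball ?c d" by (rule subset_cball) (simp add: \<delta>_def)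
    with d have "cball ?c \<delta> \<inter> medial_axis S = {}" by blast
    moreover have "?c \<noteq> p" using lt \<open>h > 0\<close> u by auto
    ultimately have "nearest_in S (?c + (\<delta> / norm (?c - p)) *\<^sub>R (?c - p)) p"
      using nearest_in_extend[OF assms(1) n\<tau>] \<delta> by blast
    moreover have "?c + (\<delta> / norm (?c - p)) *\<^sub>R (?c - p) = p + (\<tau> + \<delta>) *\<^sub>R u"
      using u lt \<open>h > 0\<close> by (simp add: algebra_simps)
    ultimately have "nearest_in S (p + (\<tau> + \<delta>) *\<^sub>R u) p" by metis
    then have "\<tau> + \<delta> \<in> A" using \<delta> lt by (simp add: A_iff)
    then show False using \<tau>(2) \<delta> by force
  qed
  then show ?thesis using \<tau>(1) by (simp add: A_iff)
qed

section \<open>Distance estimates along the ray\<close>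

text \<open>With \<open>A = |p - x|^2\<close> and \<open>B = <p - x, u>\<close>,
  \<open>g(t) = A + 2 t B + t^2\<close> is the squared distance from \<open>x\<close> to
  \<open>p + t u\<close> for a unit vector \<open>u\<close>. Since
  \<open>g(h) - g(s) = (h - s) (g'(h) - (h - s))\<close>, it is enough that
  \<open>g'(h) = 2 h + 2 B\<close> is at least \<open>h - s\<close>.\<close>

lemma quadratic_below_on_interval:
  fixes A B e h s :: real
  assumes "e > 0" "e / 2 \<le> s" "s \<le> h"
    and "A + 2 * h * B + h\<^sup>2 < e\<^sup>2"
    and "(h + 11/3 * e)\<^sup>2 < A + 2 * (h + 4 * e) * B + (h + 4 * e)\<^sup>2"
  shows "A + 2 * s * B + s\<^sup>2 < e\<^sup>2"
proof -
  \<comment> \<open>Here \<open>g(h + 4 e) - g(h) = 4 e (2 h + 2 B) + 16 e^2\<close>; the constant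
    17 adds the bound \<open>g(h) < e^2\<close>.\<close>
  have 1: "4 * e * (2 * h + 2 * B) \<ge> (h + 11/3 * e)\<^sup>2 - 17 * e\<^sup>2"
    using assms(4,5) by (simp add: power2_eq_square algebra_simps)
  have he: "h \<ge> e / 2" using assms by simp
  have "h * h \<ge> (e / 2) * (e / 2)" "h * e \<ge> (e / 2) * e"
    using he assms(1) by (intro mult_mono; simp)+
  \<comment> \<open>Right side minus left side is \<open>h^2 + 10/3 h e - 14/9 e^2\<close>, at least
    \<open>13/36 e^2\<close> when \<open>h \<ge> e/2\<close>.\<close>
  then have "4 * e * (h - e / 2) \<le> (h + 11/3 * e)\<^sup>2 - 17 * e\<^sup>2"
    using mult_pos_pos[OF assms(1) assms(1)] by (simp add: power2_eq_square algebra_simps)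
  also note 1
  finally have "h - e / 2 \<le> 2 * h + 2 * B"
    using assms(1) by (metis mult_le_cancel_left_pos mult_pos_pos zero_less_numeral)
  then have "h - s \<le> 2 * h + 2 * B" using assms by simp
  then have "(h - s) * (h - s) \<le> (h - s) * (2 * h + 2 * B)"
    using assms by (intro mult_left_mono) auto
  then show ?thesis
    using assms(4) by (simp add: power2_eq_square algebra_simps)
qed

lemma segment_to_nearest_in_ball:
  fixes S :: "'a::euclidean_space set"
  assumes "compact S" and "e > 0" and u: "norm u = 1" and "h > 0"
    and near: "nearest_in S (p + h *\<^sub>R u) p" and "dist x (p + h *\<^sub>R u) < e"
    and medial: "\<And>z. z \<in> medial_axis S \<Longrightarrow> 5 * e < dist x z"
    and q: "q \<in> S" "dist x q < e / 3"
    and s: "e / 2 \<le> s" "s \<le> h"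
  shows "dist x (p + s *\<^sub>R u) < e"
proof -
  \<comment> \<open>Moving at most \<open>4 e\<close> from a point within \<open>e\<close> of
    \<open>x\<close> stays within \<open>5 e\<close> of \<open>x\<close>.\<close>
  have off: "p + t *\<^sub>R u \<notin> medial_axis S" if "h \<le> t" "t \<le> h + 4 * e" for t
  proof
    assume "p + t *\<^sub>R u \<in> medial_axis S"
    then have "5 * e < dist x (p + t *\<^sub>R u)" by (rule medial)
    also have "\<dots> \<le> dist x (p + h *\<^sub>R u) + dist (p + h *\<^sub>R u) (p + t *\<^sub>R u)"
      by (rule dist_triangle)
    also have "dist (p + h *\<^sub>R u) (p + t *\<^sub>R u) = \<bar>h - t\<bar>"
      using u by (simp add: dist_norm flip: scaleR_left_diff_distrib)
    finally show False using assms(6) that by simp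
  qed
  let ?c = "p + (h + 4 * e) *\<^sub>R u"
  have "nearest_in S ?c p"
    by (rule nearest_in_ray[OF assms(1) u \<open>h > 0\<close> _ near off]) (use \<open>e > 0\<close> in auto)
  \<comment> \<open>\<open>q\<close> is no nearer to \<open>?c\<close> than \<open>p\<close>, which
    is at distance \<open>h + 4 e\<close>. As \<open>q\<close> is within \<open>e/3\<close> of
    \<open>x\<close>, the factor \<open>11/3 = 4 - 1/3\<close> remains.\<close>
  then have "dist ?c p \<le> dist ?c q" using q by (simp add: nearest_in_def)
  also have "\<dots> \<le> dist x ?c + dist x q" by (metis dist_commute dist_triangle)
  finally have "h + 11/3 * e < dist x ?c"
    using q u \<open>e > 0\<close> \<open>h > 0\<close> by (simp add: dist_norm)
  then have far: "(h + 11/3 * e)\<^sup>2 < (dist x ?c)\<^sup>2"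
    using \<open>e > 0\<close> \<open>h > 0\<close> by (intro power_strict_mono) auto
  have sq: "(dist x (p + t *\<^sub>R u))\<^sup>2 = (norm (p - x))\<^sup>2 + 2 * t * inner (p - x) u + t\<^sup>2" for t
  proof -
    have "dist x (p + t *\<^sub>R u) = norm ((p - x) + t *\<^sub>R u)"
      by (metis add_diff_eq add.commute dist_commute dist_norm)
    then show ?thesis
      using dot_norm[of "p - x" "t *\<^sub>R u"] u by simp
  qed
  have "(dist x (p + h *\<^sub>R u))\<^sup>2 < e\<^sup>2"
    using assms(6) by (intro power_strict_mono) auto
  then have "(dist x (p + s *\<^sub>R u))\<^sup>2 < e\<^sup>2"
    unfolding sq[of h] sq[of s]
    by (rule quadratic_below_on_interval[OF \<open>e > 0\<close> s _ far[unfolded sq[of "h + 4 * e"]]])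
  then show ?thesis
    using \<open>e > 0\<close> by (intro power2_less_imp_less[of _ e]) auto
qed

section \<open>The straight-line homotopy and the retraction\<close>

lemma homotopic_with_linear_fixing:
  fixes r :: "'a::real_normed_vector \<Rightarrow> 'a"
  assumes "continuous_on U r" and "\<And>x. x \<in> S \<Longrightarrow> r x = x"
    and "\<And>x. x \<in> U \<Longrightarrow> closed_segment x (r x) \<subseteq> U"
  shows "homotopic_with_canon (\<lambda>f. \<forall>x\<in>S. f x = x) U U id r"
proof -
  let ?h = "\<lambda>z::real \<times> 'a. (1 - fst z) *\<^sub>R snd z + fst z *\<^sub>R r (snd z)"
  have "continuous_on ({0..1} \<times> U) ?h"
    by (intro continuous_intros continuous_on_compose2[OF assms(1)]) auto
  moreover have "?h \<in> {0..1} \<times> U \<rightarrow> U"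
    using assms(3) by (fastforce simp: closed_segment_def)
  moreover have "\<forall>t\<in>{0..1}. \<forall>x\<in>S. ?h (t, x) = x"
    using assms(2) by (simp flip: scaleR_left_distrib)
  ultimately show ?thesis
    unfolding homotopic_with_def
    by (intro exI[of _ ?h]) auto
qed

theorem theorem3p15:
  fixes S X :: "'a::euclidean_space set" and \<epsilon> :: "'a \<Rightarrow> real"
  assumes "compact S" and "S \<noteq> {}" and "compact X" and "X \<noteq> {}"
    and "\<forall>x\<in>X. point_set_dist x (medial_axis S) > ereal (5 * \<epsilon> x)"
    and "\<forall>x\<in>X. point_set_dist x S < ereal (1/3 * \<epsilon> x)"
    and "\<forall>p\<in>S. \<exists>x\<in>X. norm (x - p) < 1/4 * \<epsilon> x"
    and "\<forall>x\<in>X. \<forall>y\<in>X. x \<noteq> y \<longrightarrow> \<bar>\<epsilon> x - \<epsilon> y\<bar> < 1/17 * norm (x - y)"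
  shows "S deformation_retract_of (offset X \<epsilon>)"
proof -
  let ?U = "offset X \<epsilon>" and ?\<pi> = "closest_point S"
  have cl: "closed S" using assms compact_imp_closed by blast
  have \<pi>: "nearest_in S y (?\<pi> y)" for y
    using nearest_in_closest_point[OF cl assms(2)] .
  have medial: "5 * \<epsilon> x < dist x z" if "x \<in> X" "z \<in> medial_axis S" for x z
  proof -
    have "ereal (5 * \<epsilon> x) < point_set_dist x (medial_axis S)" using assms(5) that by blast
    also have "\<dots> \<le> ereal (dist x z)"
      unfolding point_set_dist_def using that by (intro INF_lower)
    finally show ?thesis by simp
  qed
  have x\<pi>: "dist x (?\<pi> x) < \<epsilon> x / 3" if "x \<in> X" for x
  proof -
    have "ereal (dist x (?\<pi> x)) < ereal (1/3 * \<epsilon> x)"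
      using assms(6) that point_set_dist_nearest[OF \<pi>] by metis
    then show ?thesis by simp
  qed
  have pos: "\<epsilon> x > 0" if "x \<in> X" for x
    using x\<pi>[OF that] zero_le_dist[of x "?\<pi> x"] by linarith
  have off: "y \<notin> medial_axis S" if y: "y \<in> ?U" for y
  proof
    assume "y \<in> medial_axis S"
    moreover obtain x where "x \<in> X" "dist x y < \<epsilon> x"
      using y by (auto simp: offset_def)
    ultimately show False using medial[of x y] pos[of x] by simp
  qed
  have SU: "S \<subseteq> ?U"
  proof
    fix p assume "p \<in> S"
    then obtain x where "x \<in> X" "norm (x - p) < 1/4 * \<epsilon> x" using assms(7) by blast
    then show "p \<in> ?U"
      using pos[of x] by (auto simp: offset_def dist_norm intro!: bexI[of _ x])
  qed
  have cont: "continuous_on ?U ?\<pi>"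
    using continuous_on_closest_point_off_medial_axis[OF assms(1,2)]
    by (rule continuous_on_subset) (use off in blast)
  have fixes_S: "?\<pi> p = p" if "p \<in> S" for p
    using that by (rule closest_point_self)
  have seg: "closed_segment y (?\<pi> y) \<subseteq> ?U" if y: "y \<in> ?U" for y
  proof
    fix m assume m: "m \<in> closed_segment y (?\<pi> y)"
    define p where "p = ?\<pi> y"
    define h where "h = norm (y - p)"
    have pS: "p \<in> S" and near: "nearest_in S y p"
      using \<pi>[of y] by (auto simp: p_def nearest_in_def)
    obtain x where x: "x \<in> X" "dist x y < \<epsilon> x" using y by (auto simp: offset_def)
    show "m \<in> ?U"
    proof (cases "y = p")
      case True
      then show ?thesis using m y by (simp add: p_def)
    next
      case False
      then have h: "h > 0" by (simp add: h_def)
      define u where "u = (1 / h) *\<^sub>R (y - p)"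
      have u: "norm u = 1" using h by (simp add: u_def h_def)
      have yu: "y = p + h *\<^sub>R u" using h by (simp add: u_def)
      obtain t where t: "0 \<le> t" "t \<le> 1" "m = (1 - t) *\<^sub>R y + t *\<^sub>R p"
        using m by (auto simp: closed_segment_def p_def)
      \<comment> \<open>\<open>s\<close> is the distance from \<open>m\<close> to
        \<open>p\<close>.\<close>
      define s where "s = (1 - t) * h"
      have ms: "m = p + s *\<^sub>R u"
        using t(3) by (simp add: s_def yu algebra_simps)
      have s: "0 \<le> s" "s \<le> h" using t h by (auto simp: s_def mult_le_cancel_right1)
      show ?thesis
      proof (cases "s \<ge> \<epsilon> x / 2")
        case True
        have "?\<pi> x \<in> S" using \<pi>[of x] by (simp add: nearest_in_def)
        then have "dist x m < \<epsilon> x"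
          unfolding ms
          using segment_to_nearest_in_ball[OF assms(1) pos[OF x(1)] u h, of p x "?\<pi> x" s]
            near x medial[OF x(1)] x\<pi>[OF x(1)] True s yu by auto
        then show ?thesis using x by (auto simp: offset_def)
      next
        case False
        \<comment> \<open>Close to \<open>p\<close>, a sample point covering \<open>p\<close> takes
          over from \<open>x\<close>.\<close>
        obtain x' where x': "x' \<in> X" "norm (x' - p) < 1/4 * \<epsilon> x'"
          using assms(7) pS by blast
        have "dist y p \<le> dist y (?\<pi> x)"
          using near \<pi>[of x] by (simp add: nearest_in_def)
        also have "\<dots> \<le> dist x y + dist x (?\<pi> x)"
          by (metis dist_commute dist_triangle)
        finally have "dist x x' \<le> 2 * dist x y + dist x (?\<pi> x) + dist x' p"
          using dist_triangle[of x x' y] dist_triangle[of y x' p] by (simp add: dist_commute)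
        moreover have "\<bar>\<epsilon> x - \<epsilon> x'\<bar> \<le> 1/17 * dist x x'"
          using assms(8) x(1) x'(1) by (cases "x = x'") (auto simp: dist_norm less_imp_le)
        \<comment> \<open>The distance from \<open>x\<close> to \<open>x'\<close> is below
          \<open>7/3 \<epsilon> x + 1/4 \<epsilon> x'\<close>, so the Lipschitz bound gives
          \<open>\<epsilon> x' \<ge> 176/207 \<epsilon> x\<close>.\<close>
        ultimately have "\<epsilon> x' \<ge> 2/3 * \<epsilon> x"
          using x(2) x\<pi>[OF x(1)] x'(2) pos[OF x(1)] unfolding dist_norm by linarith
        moreover have "dist x' m \<le> dist x' p + s"
          using dist_triangle[of x' m p] u s by (simp add: ms dist_norm)
        \<comment> \<open>The factor 2/3 turns \<open>s < \<epsilon> x / 2\<close> into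
          \<open>s < 3/4 \<epsilon> x'\<close>; the distance from \<open>x'\<close> to
          \<open>p\<close> contributes the last quarter.\<close>
        ultimately have "dist x' m < \<epsilon> x'"
          using False x' by (simp add: dist_norm)
        then show ?thesis using x' by (auto simp: offset_def)
      qed
    qed
  qed
  have "retraction ?U S ?\<pi>"
    unfolding retraction_def
    using SU cont fixes_S closest_point_in_set[OF cl assms(2)] by auto
  then show ?thesis
    unfolding deformation_retract_of_def
    using homotopic_with_linear_fixing[OF cont fixes_S seg] by blast
qed

end
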